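(* Let $A,B\in\mathbb{C}^{n\times n}$ be such that for each $i\in\{1,\dots,n\}$ the $i$th row of at least one of $A$ and $B$ is strictly diagonally dominant. For $1\le i\le n$ put $\tilde\Gamma_i(A,B)=\tilde\Gamma_i^B(A,B)\cap\tilde\Gamma_i^A(A,B)$, where the regions $\tilde\Gamma_i^B(A,B)$ and $\tilde\Gamma_i^A(A,B)$ are those defined in the context. Then all the eigenvalues (finite or infinite) of the pencil $A-\lambda B$ lie in the union of the $n$ regions $\tilde\Gamma_i(A,B)$; that is, if $\lambda\in\mathbb{C}\cup\{\infty\}$ is an eigenvalue of the pencil, then $\lambda\in\tilde\Gamma(A,B):=\bigcup_{1\le i\le n}\tilde\Gamma_i(A,B)$.
   Context: Write $A=(a_{i,j})$, $B=(b_{i,j})$. The $i$th row of a matrix $M=(m_{i,j})$ is strictly diagonally dominant if $|m_{i,i}|>\sum_{j\ne i}|m_{i,j}|$. Eigenvalues: $\lambda\in\mathbb{C}$ is a finite eigenvalue of the pencil $A-\lambda B$ if $\det(A-\lambda B)=0$ (equivalently $A\bm{x}=\lambda B\bm{x}$ for some $\bm{x}\neq 0$). If the polynomial $\det(A-\lambda B)$ has degree $d<n$, the pencil has $n-d$ infinite eigenvalues; $\infty$ is an eigenvalue exactly when $B\bm{x}=0$ for some $\bm{x}\ne0$. All regions are subsets of the extended plane $\mathbb{C}\cup\{\infty\}$. Let $S^B$ (resp. $S^A$) be the set of $i$ such that the $i$th row of $B$ (resp. $A$) is strictly diagonally dominant. Definition of $\tilde\Gamma_i^B(A,B)$. For $i\in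 S^B$ let $r_i=\sum_{j\ne i}|b_{i,j}|/|b_{i,i}|\;(<1)$, $R_i=\sum_{j\neq i}|a_{i,j}|$, $\tilde\rho_i=\frac{|a_{i,i}|r_i+R_i(1+r_i)}{|b_{i,i}|(1-r_i^2)}$, and \[\tilde\Gamma_i^B(A,B)=\Big\{z\in\mathbb{C}:\Big|z-\frac{a_{i,i}}{b_{i,i}}\frac{1}{1-r_i^2}\Big|\le\tilde\rho_i\Big\}.\] For $i\notin S^B$, $\tilde\Gamma_i^B(A,B)$ is the whole plane, including the point $\infty$. Definition of $\tilde\Gamma_i^A(A,B)$. For $i\in S^A$ let $r_i^A=\sum_{j\ne i}|a_{i,j}|/|a_{i,i}|\;(<1)$ and $R_i^A=\sum_{j\ne i}|b_{i,j}|$. If $b_{i,i}=R_i^A=0$, then $\tilde\Gamma_i^A(A,B)=\{\infty\}$. If $b_{i,i}=0$ and $R_i^A>0$, then $\tilde\Gamma_i^A(A,B)=\{z\in\mathbb{C}:|z|\ge\frac{|a_{i,i}|}{R_i^A}(1-r_i^A)\}\cup\{\infty\}$. If $b_{i,i}\ne0$, let $\tilde\alpha_i=\frac{a_{i,i}}{b_{i,i}}(1-(r_i^A)^2)$, $\tilde\beta_i=r_i^A+\frac{R_i^A(1+r_i^A)}{|b_{i,i}|}$ and, when $\tilde\beta_i\neq1$, $\tilde c_i=\frac{\tilde\alpha_i}{1-\tilde\beta_i^2}$, $\tilde\rho_i^A=\frac{|\tilde\alpha_i|\tilde\beta_i}{|1-\tilde\beta_i^2|}$; then: if $\tilde\beta_i<1$,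 $\tilde\Gamma_i^A(A,B)=\{z\in\mathbb{C}:|z-\tilde c_i|\le\tilde\rho_i^A\}$; if $\tilde\beta_i>1$, $\tilde\Gamma_i^A(A,B)=\{z\in\mathbb{C}:|z-\tilde c_i|\ge\tilde\rho_i^A\}\cup\{\infty\}$; if $\tilde\beta_i=1$, $\tilde\Gamma_i^A(A,B)=\{z\in\mathbb{C}:|z-\tilde\alpha_i|\le|z|\}\cup\{\infty\}$. For $i\notin S^A$, $\tilde\Gamma_i^A(A,B)$ is the whole plane, including the point $\infty$. *)

theory Defs
  imports "HOL-Analysis.Analysis" "HOL-Computational_Algebra.Polynomial"
begin

text \<open>The extended plane \<open>\<complex> \<union> {\<infinity>}\<close>.\<close>

datatype ext_complex = Finite_Point complex | Infinity_Point

definition offdiag_sum :: "complex^'n^'n \<Rightarrow> 'n \<Rightarrow> real" where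
  "offdiag_sum M i = (\<Sum>j\<in>UNIV - {i}. cmod (M $ i $ j))"

definition strictly_dominant_row :: "complex^'n^'n \<Rightarrow> 'n \<Rightarrow> bool" where
  "strictly_dominant_row M i \<longleftrightarrow> cmod (M $ i $ i) > offdiag_sum M i"

definition pencil :: "complex^'n^'n \<Rightarrow> complex^'n^'n \<Rightarrow> complex \<Rightarrow> complex^'n^'n" where
  "pencil A B z = (\<chi> i j. A $ i $ j - z * B $ i $ j)"

text \<open>\<open>det (A - \<lambda> B)\<close> as a polynomial in \<open>\<lambda>\<close>.\<close>

definition pencil_poly :: "complex^'n^'n \<Rightarrow> complex^'n^'n \<Rightarrow> complex poly" where
  "pencil_poly A B = det (\<chi> i j. [:A $ i $ j, - (B $ i $ j):])"

text \<open>The pencil may be singular. Then \<^term>\<open>pencil_poly A B = 0\<close>, whose \<^const>\<open>degree\<close> is \<open>0\<close>,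
  and every point of the extended plane is an eigenvalue.\<close>

fun pencil_eigenvalue :: "complex^'n^'n \<Rightarrow> complex^'n^'n \<Rightarrow> ext_complex \<Rightarrow> bool" where
  "pencil_eigenvalue A B (Finite_Point z) \<longleftrightarrow> det (pencil A B z) = 0"
| "pencil_eigenvalue (A :: complex^'n^'n) B Infinity_Point \<longleftrightarrow> degree (pencil_poly A B) < CARD('n)"

lemma poly_pencil_poly: "poly (pencil_poly A B) z = det (pencil A B z)"
  by (simp add: pencil_poly_def pencil_def det_def poly_sum poly_prod algebra_simps)

lemma det_eq_0_iff_kernel:
  fixes M :: "complex^'n^'n"
  shows "det M = 0 \<longleftrightarrow> (\<exists>x. x \<noteq> 0 \<and> M *v x = 0)"
  by (metis invertible_det_nz invertible_left_inverse matrix_left_invertible_ker)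

lemma pencil_mult_vec: "pencil A B z *v x = A *v x - z *s (B *v x)"
  by (simp add: pencil_def matrix_vector_mult_def vec_eq_iff sum_subtractf
      sum_distrib_left algebra_simps)

lemma pencil_eigenvalue_finite_iff:
  "pencil_eigenvalue A B (Finite_Point z) \<longleftrightarrow> (\<exists>x. x \<noteq> 0 \<and> A *v x = z *s (B *v x))"
  by (simp add: det_eq_0_iff_kernel pencil_mult_vec)

lemma degree_coeff_prod_linear:
  fixes f :: "'a \<Rightarrow> complex poly"
  assumes "finite S" "\<And>i. i \<in> S \<Longrightarrow> degree (f i) \<le> 1"
  shows "degree (prod f S) \<le> card S \<and> coeff (prod f S) (card S) = (\<Prod>i\<in>S. coeff (f i) 1)"
  using assms
proof (induction S rule: finite_induct)
  case (insert a S)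
  then have d: "degree (prod f S) \<le> card S" and c: "coeff (prod f S) (card S) = (\<Prod>i\<in>S. coeff (f i) 1)"
    and a: "degree (f a) \<le> 1" by auto
  have "degree (f a * prod f S) \<le> Suc (card S)"
    using degree_mult_le[of "f a" "prod f S"] a d by linarith
  moreover have "coeff (f a * prod f S) (1 + card S) = coeff (f a) 1 * coeff (prod f S) (card S)"
  proof -
    obtain p q where f: "f a = [:p, q:]"
      using a by (metis degree1_coeffs degree_0_id degree_eq_zeroE le_eq_less_or_eq less_one pCons_0_0 pCons_eq_iff)
    show ?thesis
      using d by (simp add: f coeff_eq_0 coeff_pCons)
  qed
  ultimately show ?case using insert c by simp
qed simp

lemma
  fixes A B :: "complex^'n^'n"
  shows degree_pencil_poly_le: "degree (pencil_poly A B) \<le> CARD('n)"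
    and coeff_pencil_poly: "coeff (pencil_poly A B) CARD('n) = det (- B)"
proof -
  let ?f = "\<lambda>p i. [:A $ i $ p i, - (B $ i $ p i):]"
  have 1: "degree (prod (?f p) UNIV) \<le> CARD('n)"
    and 2: "coeff (prod (?f p) UNIV) CARD('n) = (\<Prod>i\<in>UNIV. - (B $ i $ p i))" for p :: "'n \<Rightarrow> 'n"
    using degree_coeff_prod_linear[of "UNIV :: 'n set" "?f p"] by auto
  have e: "pencil_poly A B = (\<Sum>p | p permutes UNIV. of_int (sign p) * prod (?f p) UNIV)"
    by (simp add: pencil_poly_def det_def)
  have s: "of_int k * q = smult (of_int k) q" for k and q :: "complex poly"
    by (simp add: of_int_poly)
  show "degree (pencil_poly A B) \<le> CARD('n)"
    unfolding e s by (intro degree_sum_le) (auto intro: order.trans[OF degree_smult_le] 1)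
  show "coeff (pencil_poly A B) CARD('n) = det (- B)"
    unfolding e s coeff_sum coeff_smult 2 by (simp add: det_def)
qed

lemma pencil_eigenvalue_infinity_iff:
  fixes A B :: "complex^'n^'n"
  shows "pencil_eigenvalue A B Infinity_Point \<longleftrightarrow> (\<exists>x. x \<noteq> 0 \<and> B *v x = 0)"
proof -
  have "pencil_eigenvalue A B Infinity_Point \<longleftrightarrow> coeff (pencil_poly A B) CARD('n) = 0"
    using degree_pencil_poly_le[of A B] leading_coeff_0_iff[of "pencil_poly A B"]
    by (metis coeff_eq_0 degree_0 le_less pencil_eigenvalue.simps(2) zero_less_card_finite)
  also have "\<dots> \<longleftrightarrow> (\<exists>x. x \<noteq> 0 \<and> - B *v x = 0)"
    by (simp add: coeff_pencil_poly det_eq_0_iff_kernel)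
  also have "\<dots> \<longleftrightarrow> (\<exists>x. x \<noteq> 0 \<and> B *v x = 0)"
    by (simp add: matrix_vector_mult_def vec_eq_iff sum_negf)
  finally show ?thesis .
qed

text \<open>For a strictly dominant row the diagonal entry is nonzero and the ratio is less than \<open>1\<close>.\<close>

definition dominance_ratio :: "complex^'n^'n \<Rightarrow> 'n \<Rightarrow> real" where
  "dominance_ratio M i = offdiag_sum M i / cmod (M $ i $ i)"

definition Gamma_B :: "complex^'n^'n \<Rightarrow> complex^'n^'n \<Rightarrow> 'n \<Rightarrow> ext_complex set" where
  "Gamma_B A B i =
    (if strictly_dominant_row B i then
       let a = A $ i $ i; b = B $ i $ i;
           r = dominance_ratio B i;
           R = offdiag_sum A i;
           \<rho> = (cmod a * r + R * (1 + r)) / (cmod b * (1 - r\<^sup>2))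
       in Finite_Point ` {z. cmod (z - a / b * of_real (1 / (1 - r\<^sup>2))) \<le> \<rho>}
     else UNIV)"

definition Gamma_A :: "complex^'n^'n \<Rightarrow> complex^'n^'n \<Rightarrow> 'n \<Rightarrow> ext_complex set" where
  "Gamma_A A B i =
    (if strictly_dominant_row A i then
       let a = A $ i $ i; b = B $ i $ i;
           r = dominance_ratio A i;
           R = offdiag_sum B i
       in
         if b = 0 then
           if R = 0 then {Infinity_Point}
           else Finite_Point ` {z. cmod z \<ge> cmod a / R * (1 - r)} \<union> {Infinity_Point}
         else
           let \<alpha> = a / b * of_real (1 - r\<^sup>2);
               \<beta> = r + R * (1 + r) / cmod b;
               c = \<alpha> / of_real (1 - \<beta>\<^sup>2);
               \<rho> = cmod \<alpha> * \<beta> / \<bar>1 - \<beta>\<^sup>2\<bar>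
           in
             if \<beta> < 1 then Finite_Point ` {z. cmod (z - c) \<le> \<rho>}
             else if \<beta> > 1 then Finite_Point ` {z. cmod (z - c) \<ge> \<rho>} \<union> {Infinity_Point}
             else Finite_Point ` {z. cmod (z - \<alpha>) \<le> cmod z} \<union> {Infinity_Point}
     else UNIV)"

definition Gamma_row :: "complex^'n^'n \<Rightarrow> complex^'n^'n \<Rightarrow> 'n \<Rightarrow> ext_complex set" where
  "Gamma_row A B i = Gamma_B A B i \<inter> Gamma_A A B i"

definition Gamma_region :: "complex^'n^'n \<Rightarrow> complex^'n^'n \<Rightarrow> ext_complex set" where
  "Gamma_region A B = (\<Union>i. Gamma_row A B i)"

end

theory Submission
  imports Defs
begin

text \<open>Divide the row of \<open>A x = \<lambda> B x\<close> at an entry of \<open>x\<close> of maximal modulus by that entry. This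
  leaves a scalar equation \<open>a + s = \<lambda> (b + t)\<close>, where \<open>a\<close>, \<open>b\<close> are the diagonal entries and \<open>s\<close>, \<open>t\<close>
  are bounded by the off-diagonal sums. If row \<open>i\<close> of \<open>B\<close> is dominant, then \<open>1 / (1 + t / b)\<close> lies
  in the disk with centre \<open>1 / (1 - r\<^sup>2)\<close> and radius \<open>r / (1 - r\<^sup>2)\<close>, which gives the disk for \<open>\<lambda>\<close>.
  If row \<open>i\<close> of \<open>A\<close> is dominant, the same bound holds for \<open>1 / \<lambda>\<close> (with \<open>1 / \<infinity> = 0\<close>) and reads
  \<open>\<bar>\<alpha> / \<lambda> - 1\<bar> \<le> \<beta>\<close>; inverting this disk yields the three cases on \<open>\<beta>\<close>.\<close>

text \<open>The index \<open>i\<close> depends on \<open>x\<close> only and \<open>M\<close> is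
  quantified after it, so one row serves \<open>A\<close> and \<open>B\<close> at once. This is what
  yields an intersection of two regions with the same index.\<close>

lemma max_modulus_row:
  fixes x :: "complex^'n"
  assumes "x \<noteq> 0"
  obtains i where "x $ i \<noteq> 0"
    and "\<And>M. \<exists>e. cmod e \<le> offdiag_sum M i \<and> (M *v x) $ i = (M $ i $ i + e) * x $ i"
proof -
  obtain i where i: "\<And>j. cmod (x $ j) \<le> cmod (x $ i)"
  proof -
    have "Max (range (\<lambda>j. cmod (x $ j))) \<in> range (\<lambda>j. cmod (x $ j))"
      by (rule Max_in) auto
    then obtain i where "Max (range (\<lambda>j. cmod (x $ j))) = cmod (x $ i)" by (rule imageE)
    then show thesis using that by (metis Max_ge finite finite_imageI rangeI)
  qed
  have nz: "x $ i \<noteq> 0"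
  proof
    assume "x $ i = 0"
    then have "x $ j = 0" for j using i[of j] by simp
    then show False using assms by (simp add: vec_eq_iff)
  qed
  have "\<exists>e. cmod e \<le> offdiag_sum M i \<and> (M *v x) $ i = (M $ i $ i + e) * x $ i" for M
  proof (intro exI conjI)
    let ?e = "\<Sum>j\<in>UNIV - {i}. M $ i $ j * (x $ j / x $ i)"
    have "cmod (M $ i $ j * (x $ j / x $ i)) \<le> cmod (M $ i $ j)" for j
      unfolding norm_mult norm_divide using i[of j] nz
      by (intro mult_left_le) auto
    then show "cmod ?e \<le> offdiag_sum M i"
      unfolding offdiag_sum_def by (intro sum_norm_le) auto
    have "(M *v x) $ i = M $ i $ i * x $ i + (\<Sum>j\<in>UNIV - {i}. M $ i $ j * x $ j)"
      by (simp add: matrix_vector_mult_def sum.remove[of UNIV i])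
    also have "\<dots> = (M $ i $ i + ?e) * x $ i"
      using nz by (simp add: distrib_right sum_distrib_right)
    finally show "(M *v x) $ i = (M $ i $ i + ?e) * x $ i" .
  qed
  then show thesis using that nz by blast
qed

text \<open>Division-free form of the disk for \<open>1 / (1 + \<tau>)\<close>: subtracting the
  centre \<open>1 / (1 - r\<^sup>2)\<close> leaves
  \<open>- (r\<^sup>2 + \<tau>) / ((1 + \<tau>) * (1 - r\<^sup>2))\<close>. The difference of the
  squared sides factors into two nonnegative terms.\<close>

lemma cmod_square_add_le:
  assumes "cmod \<tau> \<le> r" "r < 1"
  shows "cmod (of_real (r\<^sup>2) + \<tau>) \<le> r * cmod (1 + \<tau>)"
proof (rule power2_le_imp_le)
  have r: "0 \<le> r" using assms(1) norm_ge_zero order_trans by blast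
  then show "0 \<le> r * cmod (1 + \<tau>)" by simp
  have "(r * cmod (1 + \<tau>))\<^sup>2 - (cmod (of_real (r\<^sup>2) + \<tau>))\<^sup>2 = (1 - r\<^sup>2) * (r\<^sup>2 - (cmod \<tau>)\<^sup>2)"
    unfolding power_mult_distrib cmod_power2 by (simp, algebra)
  moreover have "r\<^sup>2 \<le> 1" "(cmod \<tau>)\<^sup>2 \<le> r\<^sup>2"
    using r assms by (simp_all add: power_le_one power_mono)
  ultimately show "(cmod (of_real (r\<^sup>2) + \<tau>))\<^sup>2 \<le> (r * cmod (1 + \<tau>))\<^sup>2"
    by (smt (verit) mult_nonneg_nonneg)
qed

text \<open>Serves both regions: with \<open>z\<close> the eigenvalue it gives the disk of
  \<open>Gamma_B\<close>, and with \<open>A\<close> and \<open>B\<close> exchanged it bounds the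
  reciprocal.\<close>

lemma quotient_disk:
  fixes a b s t z :: complex
  assumes b: "b \<noteq> 0" and r: "r < 1" and t: "cmod t \<le> r * cmod b" and s: "cmod s \<le> R"
    and eq: "a + s = z * (b + t)"
  shows "cmod (z - a / b * of_real (1 / (1 - r\<^sup>2))) \<le> (cmod a * r + R * (1 + r)) / (cmod b * (1 - r\<^sup>2))"
proof -
  define \<tau> where "\<tau> = t / b"
  have \<tau>: "cmod \<tau> \<le> r" using t b by (simp add: \<tau>_def norm_divide divide_le_eq)
  have r0: "0 \<le> r" using \<tau> norm_ge_zero order_trans by blast
  have k: "0 < 1 - r\<^sup>2" using r r0 by (simp add: power_less_one_iff)
  have lower: "1 - r \<le> cmod (1 + \<tau>)"
    using norm_triangle_ineq2[of 1 "-\<tau>"] \<tau> by simp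
  have eq': "a + s = z * b * (1 + \<tau>)" using eq b by (simp add: \<tau>_def field_simps)
  \<comment> \<open>The deviation of \<open>z\<close> from the centre, multiplied by
    \<open>b * (1 - r\<^sup>2)\<close>. Multiplying further by \<open>1 + \<tau>\<close> separates
    the contributions of \<open>s\<close> and \<open>a\<close>, and each is then bounded by a
    multiple of \<open>cmod (1 + \<tau>)\<close>.\<close>
  define w where "w = z * b * of_real (1 - r\<^sup>2) - a"
  have "w * (1 + \<tau>) = s * of_real (1 - r\<^sup>2) - a * (of_real (r\<^sup>2) + \<tau>)"
    using eq' unfolding w_def by (simp, algebra)
  then have "cmod w * cmod (1 + \<tau>) = cmod (s * of_real (1 - r\<^sup>2) - a * (of_real (r\<^sup>2) + \<tau>))"
    by (metis norm_mult)
  also have "\<dots> \<le> cmod s * (1 - r\<^sup>2) + cmod a * cmod (of_real (r\<^sup>2) + \<tau>)"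
    using norm_triangle_ineq4[of "s * of_real (1 - r\<^sup>2)" "a * (of_real (r\<^sup>2) + \<tau>)"] k
    by (simp only: norm_mult norm_of_real abs_of_pos)
  also have "\<dots> \<le> (R * (1 + r)) * cmod (1 + \<tau>) + cmod a * (r * cmod (1 + \<tau>))"
  proof (intro add_mono mult_left_mono cmod_square_add_le \<tau> r norm_ge_zero)
    have "cmod s * (1 - r\<^sup>2) \<le> R * (1 - r\<^sup>2)" using s k by (intro mult_right_mono) auto
    \<comment> \<open>Splitting \<open>1 - r\<^sup>2\<close> this way lets \<open>1 - r\<close> be
      absorbed by \<open>cmod (1 + \<tau>)\<close>; the factor \<open>1 + r\<close> in the radius is
      what remains.\<close>
    also have "\<dots> = (R * (1 + r)) * (1 - r)" by (simp add: power2_eq_square algebra_simps)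
    also have "\<dots> \<le> (R * (1 + r)) * cmod (1 + \<tau>)"
      using lower r0 order_trans[OF norm_ge_zero s] by (intro mult_left_mono) auto
    finally show "cmod s * (1 - r\<^sup>2) \<le> (R * (1 + r)) * cmod (1 + \<tau>)" .
  qed
  finally have "cmod w * cmod (1 + \<tau>) \<le> (cmod a * r + R * (1 + r)) * cmod (1 + \<tau>)"
    by (simp add: algebra_simps)
  then have w: "cmod w \<le> cmod a * r + R * (1 + r)"
    using lower r by (auto simp: mult_le_cancel_right)
  have kz: "complex_of_real (1 - r\<^sup>2) \<noteq> 0" using k by (simp only: of_real_eq_0_iff)
  have "z - a / b * of_real (1 / (1 - r\<^sup>2)) = w / (b * of_real (1 - r\<^sup>2))"
    using b kz unfolding w_def of_real_divide by (simp add: field_simps)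
  then have "cmod (z - a / b * of_real (1 / (1 - r\<^sup>2))) = cmod w / (cmod b * (1 - r\<^sup>2))"
    using k by (simp only: norm_divide norm_mult norm_of_real abs_of_pos)
  then show ?thesis using w k b by (simp add: divide_right_mono)
qed

text \<open>Apollonius: the locus \<open>\<bar>\<alpha> - z\<bar> = \<beta> \<bar>z\<bar>\<close> is a circle, obtained by completing the square.\<close>

lemma apollonius_square:
  fixes \<alpha> z :: complex
  assumes "\<beta>\<^sup>2 \<noteq> 1"
  shows "(1 - \<beta>\<^sup>2) * ((cmod (z - \<alpha> / of_real (1 - \<beta>\<^sup>2)))\<^sup>2 - (cmod \<alpha> * \<beta> / \<bar>1 - \<beta>\<^sup>2\<bar>)\<^sup>2)
    = (cmod (\<alpha> - z))\<^sup>2 - (\<beta> * cmod z)\<^sup>2"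
proof -
  define k where "k = 1 - \<beta>\<^sup>2"
  have k: "k \<noteq> 0" and \<beta>: "\<beta>\<^sup>2 = 1 - k" using assms by (auto simp: k_def)
  show ?thesis
    unfolding k_def[symmetric] power_mult_distrib power_divide power2_abs cmod_power2 \<beta>
    using k by (simp add: Re_divide_of_real Im_divide_of_real field_simps power2_eq_square)
qed

text \<open>The factor \<open>1 - \<beta>\<^sup>2\<close> in \<open>apollonius_square\<close> is
  positive, so the sign of the difference of squares carries over.\<close>

lemma apollonius_inside:
  assumes "cmod (\<alpha> - z) \<le> \<beta> * cmod z" "0 \<le> \<beta>" "\<beta> < 1"
  shows "cmod (z - \<alpha> / of_real (1 - \<beta>\<^sup>2)) \<le> cmod \<alpha> * \<beta> / \<bar>1 - \<beta>\<^sup>2\<bar>"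
proof (rule power2_le_imp_le)
  have k: "0 < 1 - \<beta>\<^sup>2" using assms by (simp add: power_less_one_iff)
  have "(cmod (\<alpha> - z))\<^sup>2 \<le> (\<beta> * cmod z)\<^sup>2" using assms by (intro power_mono) auto
  with apollonius_square[of \<beta> z \<alpha>] k
  show "(cmod (z - \<alpha> / of_real (1 - \<beta>\<^sup>2)))\<^sup>2 \<le> (cmod \<alpha> * \<beta> / \<bar>1 - \<beta>\<^sup>2\<bar>)\<^sup>2"
    by (smt (verit) mult_pos_pos)
qed (use assms in auto)

text \<open>Now \<open>1 - \<beta>\<^sup>2\<close> is negative, the comparison of squares reverses,
  and the exterior of the circle results.\<close>

lemma apollonius_outside:
  assumes "cmod (\<alpha> - z) \<le> \<beta> * cmod z" "1 < \<beta>"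
  shows "cmod \<alpha> * \<beta> / \<bar>1 - \<beta>\<^sup>2\<bar> \<le> cmod (z - \<alpha> / of_real (1 - \<beta>\<^sup>2))"
proof (rule power2_le_imp_le)
  have k: "1 - \<beta>\<^sup>2 < 0" using assms by (simp add: one_less_power)
  have "(cmod (\<alpha> - z))\<^sup>2 \<le> (\<beta> * cmod z)\<^sup>2" using assms by (intro power_mono) auto
  with apollonius_square[of \<beta> z \<alpha>] k
  show "(cmod \<alpha> * \<beta> / \<bar>1 - \<beta>\<^sup>2\<bar>)\<^sup>2 \<le> (cmod (z - \<alpha> / of_real (1 - \<beta>\<^sup>2)))\<^sup>2"
    by (smt (verit) mult_neg_neg)
qed simp

lemma offdiag_sum_nonneg: "0 \<le> offdiag_sum M i"
  by (simp add: offdiag_sum_def sum_nonneg)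

lemma strictly_dominant_rowD:
  assumes "strictly_dominant_row M i"
  shows "M $ i $ i \<noteq> 0" "dominance_ratio M i < 1" "0 \<le> dominance_ratio M i"
    "offdiag_sum M i = dominance_ratio M i * cmod (M $ i $ i)"
  using assms offdiag_sum_nonneg[of M i]
  by (auto simp: strictly_dominant_row_def dominance_ratio_def divide_less_eq)

lemma strictly_dominant_row_add_neq_0:
  assumes "strictly_dominant_row M i" "cmod e \<le> offdiag_sum M i"
  shows "M $ i $ i + e \<noteq> 0"
proof
  assume "M $ i $ i + e = 0"
  then have "cmod (M $ i $ i) = cmod e" by (metis add_eq_0_iff norm_minus_cancel)
  then show False using assms by (simp add: strictly_dominant_row_def)
qed

lemma finite_in_Gamma_B:
  assumes "cmod s \<le> offdiag_sum A i" "cmod t \<le> offdiag_sum B i"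
    and "A $ i $ i + s = z * (B $ i $ i + t)"
  shows "Finite_Point z \<in> Gamma_B A B i"
proof (cases "strictly_dominant_row B i")
  case True
  note D = strictly_dominant_rowD[OF True]
  show ?thesis
    using quotient_disk[OF D(1,2) _ assms(1,3)] assms(2) D(4) True
    by (auto simp: Gamma_B_def Let_def)
qed (simp add: Gamma_B_def)

text \<open>A dominant row of \<open>B\<close> would make \<open>B $ i $ i + t\<close> nonzero, so
  the region is the whole extended plane.\<close>

lemma infinity_in_Gamma_B:
  assumes "cmod t \<le> offdiag_sum B i" "B $ i $ i + t = 0"
  shows "Infinity_Point \<in> Gamma_B A B i"
  using strictly_dominant_row_add_neq_0 assms by (auto simp: Gamma_B_def)

text \<open>Here \<open>w\<close> stands for the reciprocal of the eigenvalue: writing the row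
  equation with \<open>w\<close> lets \<open>w = 0\<close> represent the infinite
  eigenvalue.\<close>

lemma reciprocal_disk:
  assumes "strictly_dominant_row A i" "cmod s \<le> offdiag_sum A i" "cmod t \<le> offdiag_sum B i"
    and "B $ i $ i + t = w * (A $ i $ i + s)" "B $ i $ i \<noteq> 0"
  defines "r \<equiv> dominance_ratio A i"
  shows "cmod (A $ i $ i / B $ i $ i * of_real (1 - r\<^sup>2) * w - 1)
    \<le> r + offdiag_sum B i * (1 + r) / cmod (B $ i $ i)"
proof -
  define a where "a = A $ i $ i"
  define b where "b = B $ i $ i"
  define R where "R = offdiag_sum B i"
  note D = strictly_dominant_rowD[OF assms(1), folded r_def a_def]
  have b: "b \<noteq> 0" and a: "a \<noteq> 0" using assms(5) D(1) by (simp_all add: b_def)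
  have k: "0 < 1 - r\<^sup>2" using D(2,3) by (simp add: power_less_one_iff)
  then have kz: "complex_of_real (1 - r\<^sup>2) \<noteq> 0" by (simp only: of_real_eq_0_iff)
  define \<alpha> where "\<alpha> = a / b * of_real (1 - r\<^sup>2)"
  have m: "cmod \<alpha> = cmod a / cmod b * (1 - r\<^sup>2)"
    unfolding \<alpha>_def using k by (simp only: norm_mult norm_divide norm_of_real abs_of_pos)
  have "cmod (w - b / a * of_real (1 / (1 - r\<^sup>2))) \<le> (cmod b * r + R * (1 + r)) / (cmod a * (1 - r\<^sup>2))"
    using quotient_disk[OF D(1,2) _ assms(3,4)[folded a_def b_def R_def]] assms(2) D(4) by simp
  \<comment> \<open>Since \<open>\<alpha>\<close> is the reciprocal of the centre, multiplying by it
    moves the centre to \<open>1\<close>.\<close>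
  then have "cmod \<alpha> * cmod (w - b / a * of_real (1 / (1 - r\<^sup>2)))
      \<le> cmod \<alpha> * ((cmod b * r + R * (1 + r)) / (cmod a * (1 - r\<^sup>2)))"
    by (rule mult_left_mono) simp
  also have "\<dots> = r + R * (1 + r) / cmod b"
    unfolding m using a b k by (simp add: field_simps)
  also have "cmod \<alpha> * cmod (w - b / a * of_real (1 / (1 - r\<^sup>2))) = cmod (\<alpha> * w - 1)"
    unfolding norm_mult[symmetric] \<alpha>_def of_real_divide right_diff_distrib
    using a b kz by simp
  finally show ?thesis by (simp add: \<alpha>_def a_def b_def R_def)
qed

lemma finite_in_Gamma_A:
  assumes s: "cmod s \<le> offdiag_sum A i" and t: "cmod t \<le> offdiag_sum B i"
    and eq: "A $ i $ i + s = z * (B $ i $ i + t)"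
  shows "Finite_Point z \<in> Gamma_A A B i"
proof (cases "strictly_dominant_row A i")
  case dom: True
  note D = strictly_dominant_rowD[OF dom]
  define r where "r = dominance_ratio A i"
  define R where "R = offdiag_sum B i"
  have nz: "A $ i $ i + s \<noteq> 0" using strictly_dominant_row_add_neq_0[OF dom s] .
  then have z: "z \<noteq> 0" using eq by auto
  show ?thesis
  proof (cases "B $ i $ i = 0")
    case b: True
    \<comment> \<open>Dominance of the row of \<open>A\<close> rules out \<open>R = 0\<close>, the
      case whose region contains no finite point.\<close>
    have "t \<noteq> 0" using nz eq b by auto
    then have R: "R > 0" using t by (simp add: R_def less_le_trans[OF zero_less_norm_iff[THEN iffD2]])
    have "cmod (A $ i $ i) * (1 - r) \<le> cmod (A $ i $ i + s)"
      using s D(4) norm_triangle_ineq2[of "A $ i $ i" "- s"] by (simp add: r_def algebra_simps)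
    also have "\<dots> = cmod z * cmod t" using eq b by (simp add: norm_mult)
    also have "\<dots> \<le> cmod z * R" using t by (simp add: R_def mult_left_mono)
    finally have "cmod (A $ i $ i) / R * (1 - r) \<le> cmod z" using R by (simp add: field_simps)
    then show ?thesis using dom b R by (simp add: Gamma_A_def Let_def R_def r_def)
  next
    case b: False
    define \<alpha> where "\<alpha> = A $ i $ i / B $ i $ i * of_real (1 - r\<^sup>2)"
    define \<beta> where "\<beta> = r + R * (1 + r) / cmod (B $ i $ i)"
    have "B $ i $ i + t = 1 / z * (A $ i $ i + s)" using eq z by simp
    from reciprocal_disk[OF dom s t this b]
    have disk: "cmod (\<alpha> * (1 / z) - 1) \<le> \<beta>" by (simp only: \<alpha>_def \<beta>_def r_def R_def)
    have "cmod (\<alpha> - z) = cmod (\<alpha> * (1 / z) - 1) * cmod z"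
      unfolding norm_mult[symmetric] left_diff_distrib using z by simp
    also have "\<dots> \<le> \<beta> * cmod z" using disk by (simp add: mult_right_mono)
    finally have le: "cmod (\<alpha> - z) \<le> \<beta> * cmod z" .
    have \<beta>: "0 \<le> \<beta>" using disk norm_ge_zero order_trans by blast
    have G: "Gamma_A A B i =
        (if \<beta> < 1 then Finite_Point ` {z. cmod (z - \<alpha> / of_real (1 - \<beta>\<^sup>2)) \<le> cmod \<alpha> * \<beta> / \<bar>1 - \<beta>\<^sup>2\<bar>}
         else if \<beta> > 1 then Finite_Point ` {z. cmod (z - \<alpha> / of_real (1 - \<beta>\<^sup>2)) \<ge> cmod \<alpha> * \<beta> / \<bar>1 - \<beta>\<^sup>2\<bar>} \<union> {Infinity_Point}
         else Finite_Point ` {z. cmod (z - \<alpha>) \<le> cmod z} \<union> {Infinity_Point})"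
      using dom b by (simp only: Gamma_A_def Let_def \<alpha>_def \<beta>_def r_def R_def if_True if_False)
    consider "\<beta> < 1" | "\<beta> > 1" | "\<beta> = 1" by linarith
    then show ?thesis
    proof cases
      case 1 then show ?thesis using apollonius_inside[OF le \<beta>] unfolding G by auto
    next
      case 2 then show ?thesis using apollonius_outside[OF le] unfolding G by auto
    next
      case 3 then show ?thesis using le unfolding G by (simp add: norm_minus_commute)
    qed
  qed
qed (simp add: Gamma_A_def)

text \<open>Every case of the region contains the infinite point except \<open>\<beta> < 1\<close>,
  so for a dominant row with nonzero diagonal entry of \<open>B\<close> it suffices to show
  \<open>1 \<le> \<beta>\<close>.\<close>

lemma infinity_in_Gamma_A:
  assumes t: "cmod t \<le> offdiag_sum B i" and eq: "B $ i $ i + t = 0"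
  shows "Infinity_Point \<in> Gamma_A A B i"
proof (cases "strictly_dominant_row A i \<and> B $ i $ i \<noteq> 0")
  case True
  \<comment> \<open>At \<open>w = 0\<close> the left side of \<open>reciprocal_disk\<close> is
    \<open>cmod (- 1)\<close>; the choice \<open>s = 0\<close> is an admissible
    perturbation.\<close>
  then have "1 \<le> dominance_ratio A i
      + offdiag_sum B i * (1 + dominance_ratio A i) / cmod (B $ i $ i)"
    using reciprocal_disk[of A i 0 t B 0, OF _ _ t] offdiag_sum_nonneg[of A i] eq
    by (simp del: of_real_diff)
  then have "\<not> dominance_ratio A i
      + offdiag_sum B i * (1 + dominance_ratio A i) / cmod (B $ i $ i) < 1"
    by (rule leD)
  with True show ?thesis
    by (simp only: Gamma_A_def Let_def if_True if_False simp_thms) auto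
qed (auto simp: Gamma_A_def Let_def)

theorem theorem2p10:
  fixes A B :: "complex^'n^'n"
  assumes "\<And>i. strictly_dominant_row A i \<or> strictly_dominant_row B i"
    and "pencil_eigenvalue A B l"
  shows "l \<in> Gamma_region A B"
proof (cases l)
  case (Finite_Point z)
  then obtain x where x: "x \<noteq> 0" "A *v x = z *s (B *v x)"
    using assms(2) pencil_eigenvalue_finite_iff by blast
  obtain i where i: "x $ i \<noteq> 0"
    "\<And>M. \<exists>e. cmod e \<le> offdiag_sum M i \<and> (M *v x) $ i = (M $ i $ i + e) * x $ i"
    using max_modulus_row[OF x(1)] by blast
  obtain s t where s: "cmod s \<le> offdiag_sum A i" "(A *v x) $ i = (A $ i $ i + s) * x $ i"
    and t: "cmod t \<le> offdiag_sum B i" "(B *v x) $ i = (B $ i $ i + t) * x $ i"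
    using i(2) by blast
  have "(A $ i $ i + s) * x $ i = (z * (B $ i $ i + t)) * x $ i"
    by (metis s(2) t(2) x(2) mult.assoc vector_smult_component)
  then have "A $ i $ i + s = z * (B $ i $ i + t)" unfolding mult_right_cancel[OF i(1)] .
  from finite_in_Gamma_B[OF s(1) t(1) this] finite_in_Gamma_A[OF s(1) t(1) this]
  show ?thesis by (auto simp: Finite_Point Gamma_region_def Gamma_row_def)
next
  case Infinity_Point
  then obtain x where x: "x \<noteq> 0" "B *v x = 0"
    using assms(2) pencil_eigenvalue_infinity_iff by blast
  obtain i where i: "x $ i \<noteq> 0"
    "\<And>M. \<exists>e. cmod e \<le> offdiag_sum M i \<and> (M *v x) $ i = (M $ i $ i + e) * x $ i"
    using max_modulus_row[OF x(1)] by blast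
  obtain t where t: "cmod t \<le> offdiag_sum B i" "(B *v x) $ i = (B $ i $ i + t) * x $ i"
    using i(2) by blast
  then have "B $ i $ i + t = 0" using x(2) i(1) by simp
  from infinity_in_Gamma_B[OF t(1) this] infinity_in_Gamma_A[OF t(1) this]
  show ?thesis by (auto simp: Infinity_Point Gamma_region_def Gamma_row_def)
qed

end
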